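(* Let $0<\alpha\le 1$, let $m,n$ be natural numbers, and let $L_n^m(\tfrac{x^\alpha}{\alpha})=(-1)^m D^{m\alpha}L_{n+m}(\tfrac{x^\alpha}{\alpha})$ be the conformable associated Laguerre function. Then for all $x\ge 0$, $$L_n^m\!\left(\frac{x^\alpha}{\alpha}\right)=\sum_{r=0}^{n}(-1)^{r}\frac{(n+m)!}{\alpha^{r}\,(n-r)!\,(r+m)!\,r!}\,x^{r\alpha}.$$
   Context: For $0<\alpha\le 1$, the conformable derivative of order $\alpha$ of a function $f$ at $x>0$ is $D^\alpha f(x)=\lim_{\epsilon\to 0}\frac{f(x+\epsilon x^{1-\alpha})-f(x)}{\epsilon}$, and at $x=0$ it is defined by $D^\alpha f(0)=\lim_{x\to 0^+}D^\alpha f(x)$ when the limit exists. $D^{m\alpha}$ denotes the $m$-fold composition $D^\alpha\circ\cdots\circ D^\alpha$ (with $D^0$ the identity), acting in the variable $x$. For a natural number $N$, the conformable Laguerre polynomial of order $N$ is $$L_N\!\left(\frac{x^\alpha}{\alpha}\right)=\sum_{k=0}^N (-1)^k \frac{N!}{\alpha^k\,(N-k)!\,(k!)^2}\,x^{k\alpha},$$ with $x^0=1$ also at $x=0$. *)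

theory Defs
  imports Complex_Main
begin

text \<open>
  The library has \<open>0 powr 0 = 0\<close>; here \<open>x\<^sup>0 = 1\<close> also at \<open>x = 0\<close>.
\<close>
definition rpow :: "real \<Rightarrow> real \<Rightarrow> real" where
  "rpow x a = (if a = 0 then 1 else x powr a)"

definition conformable_quotient :: "real \<Rightarrow> (real \<Rightarrow> real) \<Rightarrow> real \<Rightarrow> real \<Rightarrow> real" where
  "conformable_quotient \<alpha> f x \<epsilon> = (f (x + \<epsilon> * rpow x (1 - \<alpha>)) - f x) / \<epsilon>"

text \<open>
  \<open>Lim\<close> is meaningful only where the limit exists, which is what
  \<open>conformable_differentiable\<close> below expresses. Negative arguments are outside the domain.
\<close>
definition conformable_deriv :: "real \<Rightarrow> (real \<Rightarrow> real) \<Rightarrow> real \<Rightarrow> real" where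
  "conformable_deriv \<alpha> f x =
     (if x > 0 then Lim (at 0) (conformable_quotient \<alpha> f x)
      else if x = 0 then Lim (at_right 0) (\<lambda>t. Lim (at 0) (conformable_quotient \<alpha> f t))
      else undefined)"

definition conformable_differentiable :: "real \<Rightarrow> (real \<Rightarrow> real) \<Rightarrow> real \<Rightarrow> bool" where
  "conformable_differentiable \<alpha> f x \<longleftrightarrow>
     (if x > 0 then \<exists>l. (conformable_quotient \<alpha> f x \<longlongrightarrow> l) (at 0)
      else if x = 0 then
        (\<forall>\<^sub>F t in at_right 0. \<exists>l. (conformable_quotient \<alpha> f t \<longlongrightarrow> l) (at 0)) \<and>
        (\<exists>l. (conformable_deriv \<alpha> f \<longlongrightarrow> l) (at_right 0))
      else False)"

definition conformable_laguerre :: "real \<Rightarrow> nat \<Rightarrow> real \<Rightarrow> real" where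
  "conformable_laguerre \<alpha> N x =
     (\<Sum>k=0..N. (-1) ^ k * (fact N / (\<alpha> ^ k * fact (N - k) * (fact k)\<^sup>2)) * rpow x (real k * \<alpha>))"

definition conformable_assoc_laguerre :: "real \<Rightarrow> nat \<Rightarrow> nat \<Rightarrow> real \<Rightarrow> real" where
  "conformable_assoc_laguerre \<alpha> n m x =
     (-1) ^ m * (conformable_deriv \<alpha> ^^ m) (conformable_laguerre \<alpha> (n + m)) x"

end

theory Submission
  imports Defs
begin

text \<open>
  At \<open>x > 0\<close> the substitution \<open>h = \<epsilon> x\<^bsup>1-\<alpha>\<^esup>\<close> gives \<open>D\<^sup>\<alpha> f(x) = x\<^bsup>1-\<alpha>\<^esup> f'(x)\<close>, so \<open>D\<^sup>\<alpha>\<close> acts on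
  polynomials in \<open>x\<^sup>\<alpha>\<close> by \<open>D\<^sup>\<alpha> x\<^bsup>k\<alpha>\<^esup> = k \<alpha> x\<^bsup>(k-1)\<alpha>\<^esup>\<close>. These polynomials are right-continuous at \<open>0\<close>,
  so the same rule holds there, and the coefficients of the iterated derivatives follow by induction.
\<close>

definition conformable_poly :: "real \<Rightarrow> (nat \<Rightarrow> real) \<Rightarrow> nat \<Rightarrow> real \<Rightarrow> real" where
  "conformable_poly \<alpha> c N x = (\<Sum>k=0..N. c k * rpow x (real k * \<alpha>))"

text \<open>The conformable quotient is the ordinary difference quotient at 0 of \<open>e\<close>
  mapped to \<open>f (x + e * ?w)\<close>, so the chain rule yields the limit.\<close>

lemma conformable_quotient_tendsto:
  assumes "(f has_real_derivative D) (at x)"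
  shows "(conformable_quotient \<alpha> f x \<longlongrightarrow> D * rpow x (1 - \<alpha>)) (at 0)"
proof -
  let ?w = "rpow x (1 - \<alpha>)"
  have "((\<lambda>e. f (x + e * ?w)) has_real_derivative D * ?w) (at 0)"
  proof (rule DERIV_chain2[where f = f])
    show "(f has_real_derivative D) (at (x + 0 * ?w))"
      using assms by simp
    show "((\<lambda>e. x + e * ?w) has_real_derivative ?w) (at 0)"
      by (auto intro!: derivative_eq_intros)
  qed
  then show ?thesis
    unfolding conformable_quotient_def[abs_def] by (simp add: DERIV_def)
qed

lemma has_real_derivative_rpow:
  assumes "x > 0"
  shows "((\<lambda>x. rpow x a) has_real_derivative a * x powr (a - 1)) (at x)"
  using assms by (cases "a = 0") (auto simp: rpow_def intro!: has_real_derivative_powr)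

lemma has_real_derivative_conformable_poly:
  assumes "x > 0"
  shows "(conformable_poly \<alpha> c N has_real_derivative
           (\<Sum>k=0..N. c k * (real k * \<alpha> * x powr (real k * \<alpha> - 1)))) (at x)"
  unfolding conformable_poly_def[abs_def]
  by (intro DERIV_sum DERIV_cmult has_real_derivative_rpow assms)

text \<open>Needed because the derivative at 0 is a right limit. For \<open>k > 0\<close> the
  exponent is positive and the power tends to 0; for \<open>k = 0\<close> the convention in
  \<open>rpow\<close> makes it constantly 1.\<close>

lemma conformable_poly_tendsto_at_right_0:
  assumes "\<alpha> > 0"
  shows "(conformable_poly \<alpha> c N \<longlongrightarrow> conformable_poly \<alpha> c N 0) (at_right 0)"
  unfolding conformable_poly_def[abs_def]
proof (intro tendsto_sum tendsto_mult tendsto_const)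
  fix k
  show "((\<lambda>x. rpow x (real k * \<alpha>)) \<longlongrightarrow> rpow 0 (real k * \<alpha>)) (at_right 0)"
  proof (cases "k = 0")
    case True
    then show ?thesis by (simp add: rpow_def)
  next
    case False
    have "((\<lambda>x::real. x powr (real k * \<alpha>)) \<longlongrightarrow> 0 powr (real k * \<alpha>)) (at_right 0)"
      using False assms
      by (intro tendsto_powr2 tendsto_ident_at tendsto_const)
        (auto intro: eventually_mono[OF eventually_at_right_less])
    then show ?thesis
      using False assms by (simp add: rpow_def)
  qed
qed

text \<open>Agreement is assumed only for \<open>y \<ge> 0\<close> because the lemma is applied to
  iterated derivatives, which are \<open>undefined\<close> at negative arguments. Since
  \<open>x > 0\<close>, agreement on an open neighbourhood suffices.\<close>

lemma conformable_quotient_poly_tendsto: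
  assumes "\<And>y. y \<ge> 0 \<Longrightarrow> f y = conformable_poly \<alpha> c (Suc N) y" and "x > 0" and "\<alpha> > 0"
  shows "(conformable_quotient \<alpha> f x \<longlongrightarrow>
           conformable_poly \<alpha> (\<lambda>k. c (Suc k) * (real (Suc k) * \<alpha>)) N x) (at 0)"
proof -
  let ?D = "\<Sum>k=0..Suc N. c k * (real k * \<alpha> * x powr (real k * \<alpha> - 1))"
  have "(f has_real_derivative ?D) (at x)"
    by (rule has_field_derivative_transform_within_open
          [OF has_real_derivative_conformable_poly[OF \<open>x > 0\<close>], where S = "{0<..}"])
      (use assms in auto)
  then have "(conformable_quotient \<alpha> f x \<longlongrightarrow> ?D * rpow x (1 - \<alpha>)) (at 0)"
    by (rule conformable_quotient_tendsto)
  moreover have "?D * rpow x (1 - \<alpha>) =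
      conformable_poly \<alpha> (\<lambda>k. c (Suc k) * (real (Suc k) * \<alpha>)) N x"
  proof -
    have w: "rpow x (1 - \<alpha>) = x powr (1 - \<alpha>)"
      using \<open>x > 0\<close> by (simp add: rpow_def)
    have "x powr (real (Suc k) * \<alpha> - 1) * x powr (1 - \<alpha>) = rpow x (real k * \<alpha>)" for k
      using \<open>x > 0\<close> by (auto simp: rpow_def algebra_simps simp flip: powr_add)
    \<comment> \<open>The factor \<open>real k\<close> kills the term \<open>k = 0\<close>; shifting
      the index turns the remaining terms into those of the target.\<close>
    then show ?thesis
      by (simp add: conformable_poly_def sum.atLeast0_atMost_Suc_shift w sum_distrib_right mult.assoc
          del: sum.cl_ivl_Suc of_nat_Suc)
  qed
  ultimately show ?thesis by simp
qed

text \<open>The right limit that defines the value at 0 sees only positive points, where the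
  derivative is already the polynomial \<open>?g\<close>; right-continuity of \<open>?g\<close> then
  gives both existence and value.\<close>

lemma conformable_deriv_poly:
  assumes f: "\<And>y. y \<ge> 0 \<Longrightarrow> f y = conformable_poly \<alpha> c (Suc N) y" and "x \<ge> 0" and "\<alpha> > 0"
  shows "conformable_deriv \<alpha> f x = conformable_poly \<alpha> (\<lambda>k. c (Suc k) * (real (Suc k) * \<alpha>)) N x"
    and "conformable_differentiable \<alpha> f x"
proof -
  let ?g = "conformable_poly \<alpha> (\<lambda>k. c (Suc k) * (real (Suc k) * \<alpha>)) N"
  have q: "(conformable_quotient \<alpha> f t \<longlongrightarrow> ?g t) (at 0)" if "t > 0" for t
    using conformable_quotient_poly_tendsto[OF f that \<open>\<alpha> > 0\<close>] by simp
  then have L: "Lim (at 0) (conformable_quotient \<alpha> f t) = ?g t" if "t > 0" for t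
    using that by (intro tendsto_Lim) auto
  have ev: "\<forall>\<^sub>F t in at_right 0. t > (0::real)"
    by (rule eventually_at_right_less)
  have g0: "(?g \<longlongrightarrow> ?g 0) (at_right 0)"
    by (rule conformable_poly_tendsto_at_right_0[OF \<open>\<alpha> > 0\<close>])
  have lim0: "((\<lambda>t. Lim (at 0) (conformable_quotient \<alpha> f t)) \<longlongrightarrow> ?g 0) (at_right 0)"
    by (rule Lim_transform_eventually[OF g0 eventually_mono[OF ev]]) (simp add: L)
  show "conformable_deriv \<alpha> f x = ?g x"
    using \<open>x \<ge> 0\<close> L tendsto_Lim[OF _ lim0] by (cases "x = 0") (auto simp: conformable_deriv_def)
  have "(conformable_deriv \<alpha> f \<longlongrightarrow> ?g 0) (at_right 0)"
    by (rule Lim_transform_eventually[OF g0 eventually_mono[OF ev]])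
      (simp add: L conformable_deriv_def)
  moreover have "\<forall>\<^sub>F t in at_right 0. \<exists>l. (conformable_quotient \<alpha> f t \<longlongrightarrow> l) (at 0)"
    by (rule eventually_mono[OF ev]) (use q in blast)
  ultimately show "conformable_differentiable \<alpha> f x"
    using \<open>x \<ge> 0\<close> q[of x] by (cases "x = 0") (auto simp: conformable_differentiable_def)
qed

text \<open>The term of index \<open>k = r + j\<close> lands at index \<open>r\<close> with the
  factor \<open>\<alpha> ^ j * fact k / fact r\<close>, which turns \<open>(fact k)\<^sup>2\<close>
  in the denominator into \<open>fact (r + j) * fact r\<close>.\<close>

lemma conformable_deriv_funpow_laguerre:
  assumes "\<alpha> > 0" and "x \<ge> 0"
  shows "(conformable_deriv \<alpha> ^^ j) (conformable_laguerre \<alpha> (M + j)) x =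
    conformable_poly \<alpha>
      (\<lambda>r. (-1) ^ (r + j) * (fact (M + j) / (\<alpha> ^ r * fact (M - r) * fact (r + j) * fact r))) M x"
  using \<open>x \<ge> 0\<close>
\<comment> \<open>\<open>M\<close> must vary: \<open>M + Suc j = Suc M + j\<close>, so the
  hypothesis is used at \<open>Suc M\<close>, and the last derivative lowers the degree to
  \<open>M\<close>.\<close>
proof (induction j arbitrary: M x)
  case 0
  then show ?case
    by (simp add: conformable_laguerre_def conformable_poly_def power2_eq_square mult.assoc)
next
  case (Suc j)
  define c where "c = (\<lambda>r. (-1) ^ (r + j) *
    (fact (Suc M + j) / (\<alpha> ^ r * fact (Suc M - r) * fact (r + j) * fact r)))"
  have "(conformable_deriv \<alpha> ^^ j) (conformable_laguerre \<alpha> (M + Suc j)) y =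
      conformable_poly \<alpha> c (Suc M) y" if "y \<ge> 0" for y
    using Suc.IH[OF that, of "Suc M"] by (simp add: c_def)
  then have "(conformable_deriv \<alpha> ^^ Suc j) (conformable_laguerre \<alpha> (M + Suc j)) x =
      conformable_poly \<alpha> (\<lambda>k. c (Suc k) * (real (Suc k) * \<alpha>)) M x"
    using conformable_deriv_poly(1) \<open>\<alpha> > 0\<close> Suc.prems by simp
  also have "(\<lambda>k. c (Suc k) * (real (Suc k) * \<alpha>)) = (\<lambda>r. (-1) ^ (r + Suc j) *
      (fact (M + Suc j) / (\<alpha> ^ r * fact (M - r) * fact (r + Suc j) * fact r)))"
  proof
    fix r
    \<comment> \<open>Only this factorial is unfolded, to cancel the new factor
      \<open>real (Suc r)\<close>; \<open>fact (Suc r + j)\<close> has to stay intact.\<close>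
    have "fact (Suc r) = real (Suc r) * fact r" by simp
    then show "c (Suc r) * (real (Suc r) * \<alpha>) = (-1) ^ (r + Suc j) *
      (fact (M + Suc j) / (\<alpha> ^ r * fact (M - r) * fact (r + Suc j) * fact r))"
      using \<open>\<alpha> > 0\<close> by (simp add: c_def del: fact_Suc of_nat_Suc)
  qed
  finally show ?case .
qed

theorem mainTheorem6:
  fixes \<alpha> :: real and m n :: nat
  assumes "0 < \<alpha>" and "\<alpha> \<le> 1"
  shows "(\<forall>k<m. \<forall>x\<ge>0. conformable_differentiable \<alpha>
              ((conformable_deriv \<alpha> ^^ k) (conformable_laguerre \<alpha> (n + m))) x) \<and>
         (\<forall>x\<ge>0. conformable_assoc_laguerre \<alpha> n m x =
           (\<Sum>r=0..n. (-1) ^ r * (fact (n + m) / (\<alpha> ^ r * fact (n - r) * fact (r + m) * fact r))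
              * rpow x (real r * \<alpha>)))"
proof (intro conjI allI impI)
  fix k :: nat and x :: real
  assume "k < m" "x \<ge> 0"
  \<comment> \<open>As \<open>k < m\<close>, the \<open>k\<close>-th derivative has degree bound
    \<open>Suc (n + d)\<close>, the successor form that \<open>conformable_deriv_poly\<close>
    requires.\<close>
  then obtain d where "m = Suc (d + k)"
    by (metis less_iff_Suc_add add.commute)
  then have "n + m = Suc (n + d) + k" by simp
  then show "conformable_differentiable \<alpha>
      ((conformable_deriv \<alpha> ^^ k) (conformable_laguerre \<alpha> (n + m))) x"
    using conformable_deriv_poly(2)[OF conformable_deriv_funpow_laguerre] \<open>0 < \<alpha>\<close> \<open>x \<ge> 0\<close> by metis
next
  fix x :: real
  assume "x \<ge> 0"
  \<comment> \<open>The prefactor \<open>(-1) ^ m\<close> of the associated function cancels the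
    sign produced by the index shift.\<close>
  have sign: "(-1) ^ m * ((-1) ^ (r + m) * a * b) = (-1) ^ r * a * b" for r and a b :: real
    by (simp add: power_add flip: power_mult_distrib)
  show "conformable_assoc_laguerre \<alpha> n m x =
      (\<Sum>r=0..n. (-1) ^ r * (fact (n + m) / (\<alpha> ^ r * fact (n - r) * fact (r + m) * fact r))
              * rpow x (real r * \<alpha>))"
    unfolding conformable_assoc_laguerre_def conformable_poly_def sum_distrib_left sign
      conformable_deriv_funpow_laguerre[OF \<open>0 < \<alpha>\<close> \<open>x \<ge> 0\<close>] ..
qed

end
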